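(* For every convex point set $P$ with $n$ points in the plane, there exists an increasing-chord geometric graph $G(P,S)$ with vertex set $P$ such that $|S|\in O(n\log n)$.
   Context: A convex point set is a finite point set in the plane in which no point is a convex combination of the others. A geometric graph $(P,S)$ consists of the point set $P$ and a set $S$ of straight-line segments (edges) between points of $P$. For points $p,q$, $|\overline{pq}|$ is the Euclidean length of $\overline{pq}$. A geometric path $(v_1,\dots,v_n)$ is self-approaching from $v_1$ to $v_n$ if for every three distinct points $a,b,c$ appearing in this order along the path from $v_1$ to $v_n$ (possibly interior to edges) we have $|\overline{bc}|<|\overline{ac}|$. A geometric graph is increasing-chord if for every pair of vertices $u,v$ it contains a path between $u$ and $v$ that is self-approaching both from $u$ to $v$ and from $v$ to $u$. No Steiner points are allowed: the vertex set is exactly $P$. *)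

theory Defs
  imports "HOL-Analysis.Analysis"
begin

type_synonym point = "real^2"

definition convex_point_set :: "point set \<Rightarrow> bool" where
  "convex_point_set P \<longleftrightarrow> finite P \<and> (\<forall>p\<in>P. p \<notin> convex hull (P - {p}))"

text \<open>Geometric graph (P,S): S is a set of straight-line segments, each given by its
  (unordered) pair of distinct endpoints in P.\<close>
definition geometric_graph :: "point set \<Rightarrow> point set set \<Rightarrow> bool" where
  "geometric_graph P S \<longleftrightarrow> (\<forall>e\<in>S. \<exists>p q. p \<in> P \<and> q \<in> P \<and> p \<noteq> q \<and> e = {p, q})"

definition is_graph_path :: "point set \<Rightarrow> point set set \<Rightarrow> point list \<Rightarrow> bool" where
  "is_graph_path P S vs \<longleftrightarrow> vs \<noteq> [] \<and> set vs \<subseteq> P \<and>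
     (\<forall>i. Suc i < length vs \<longrightarrow> {vs ! i, vs ! Suc i} \<in> S)"

text \<open>Piecewise-linear parametrisation of the polygonal path over [0, length vs - 1];
  parameter value k (integer) is the vertex vs!k.\<close>
definition path_point :: "point list \<Rightarrow> real \<Rightarrow> point" where
  "path_point vs t = (let i = min (nat \<lfloor>t\<rfloor>) (length vs - 2) in
      (1 - (t - real i)) *\<^sub>R (vs ! i) + (t - real i) *\<^sub>R (vs ! Suc i))"

definition self_approaching :: "point list \<Rightarrow> bool" where
  "self_approaching vs \<longleftrightarrow>
     (\<forall>s t u. 0 \<le> s \<and> s \<le> t \<and> t \<le> u \<and> u \<le> real (length vs - 1) \<longrightarrow>
        (let a = path_point vs s; b = path_point vs t; c = path_point vs u in
          a \<noteq> b \<and> b \<noteq> c \<and> a \<noteq> c \<longrightarrow> dist b c < dist a c))"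

definition increasing_chord :: "point set \<Rightarrow> point set set \<Rightarrow> bool" where
  "increasing_chord P S \<longleftrightarrow> geometric_graph P S \<and>
     (\<forall>u\<in>P. \<forall>v\<in>P. u \<noteq> v \<longrightarrow>
        (\<exists>vs. is_graph_path P S vs \<and> hd vs = u \<and> last vs = v \<and>
              self_approaching vs \<and> self_approaching (rev vs)))"

end

theory Submission
  imports Defs
begin

text \<open>A path whose edge vectors all lie in one closed right angle has increasing chords. Give each
  point an outer normal, a direction in which it is the unique maximum of the set. In a fixed
  orthogonal frame, the points with normals in a given quadrant form a chain monotone in both
  coordinates, and any two points with normals in adjacent quadrants are joined by right-angle
  paths in a graph of linear size. Rotating the frame makes the normals in the first and third
  quadrants exactly half of all normals; recursion on the two halves settles the remaining pairs.\<close>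

section \<open>Orthogonal frames and the sign of the inner product\<close>

text \<open>The coordinate form of: the vectors are orthogonal, of common length \<open>sqrt c\<close>.\<close>
definition frame :: "point \<Rightarrow> point \<Rightarrow> bool" where
  "frame e f \<longleftrightarrow> (\<exists>c>0. \<forall>v w. c * (v \<bullet> w) = (e \<bullet> v) * (e \<bullet> w) + (f \<bullet> v) * (f \<bullet> w))"

lemma frame_mirror: "frame e f \<Longrightarrow> frame (- e) f"
  by (simp add: frame_def)

lemma frame_rotate: "frame e f \<Longrightarrow> frame f (- e)"
  by (simp add: frame_def add.commute)

lemma frame_neg: "frame e f \<Longrightarrow> frame (- e) (- f)"
  by (simp add: frame_def)

lemma frame_inner_nonneg:
  assumes "frame e f" "0 \<le> (e \<bullet> v) * (e \<bullet> w)" "0 \<le> (f \<bullet> v) * (f \<bullet> w)"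
  shows "0 \<le> v \<bullet> w"
proof -
  obtain c where "0 < c" "c * (v \<bullet> w) = (e \<bullet> v) * (e \<bullet> w) + (f \<bullet> v) * (f \<bullet> w)"
    using assms(1) unfolding frame_def by blast
  then show ?thesis
    using assms(2,3) by (metis add_nonneg_nonneg zero_le_mult_iff not_less)
qed

lemma frame_inner_nonpos:
  assumes "frame e f" "(e \<bullet> v) * (e \<bullet> w) \<le> 0" "(f \<bullet> v) * (f \<bullet> w) \<le> 0"
  shows "v \<bullet> w \<le> 0"
proof -
  have "0 \<le> (- v) \<bullet> w"
    using assms(2,3) by (intro frame_inner_nonneg[OF assms(1)]) simp_all
  then show ?thesis
    by simp
qed

text \<open>The second vector is the first after a quarter turn, and the scale is the squared
  length. Without normalisation, frames can depend polynomially on a parameter, as in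
  \<open>balanced_frame\<close>.\<close>

lemma frame_coordinates:
  fixes a b :: real
  assumes "a \<noteq> 0 \<or> b \<noteq> 0"
  shows "frame (vector [a, b]) (vector [- b, a])"
proof -
  have "a\<^sup>2 + b\<^sup>2 > 0"
    using assms by (simp add: sum_power2_gt_zero_iff)
  then show ?thesis
    unfolding frame_def
    by (intro exI[of _ "a\<^sup>2 + b\<^sup>2"])
      (simp add: inner_vec_def sum_2 algebra_simps power2_eq_square)
qed

section \<open>Paths monotone in a quadrant\<close>

definition quadrant_path :: "point set \<Rightarrow> point set set \<Rightarrow> point \<Rightarrow> point \<Rightarrow> point list \<Rightarrow> bool" where
  "quadrant_path P S e f vs \<longleftrightarrow> is_graph_path P S vs \<and>
     (\<forall>i. Suc i < length vs \<longrightarrow> e \<bullet> vs ! i \<le> e \<bullet> vs ! Suc i \<and> f \<bullet> vs ! i \<le> f \<bullet> vs ! Suc i)"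

text \<open>The frame is chosen separately for each pair, so graphs built in different frames can
  simply be united.\<close>

definition reachable :: "point set \<Rightarrow> point set set \<Rightarrow> point \<Rightarrow> point \<Rightarrow> bool" where
  "reachable P S u v \<longleftrightarrow>
     (\<exists>e f vs. frame e f \<and> quadrant_path P S e f vs \<and> hd vs = u \<and> last vs = v)"

text \<open>The functional is affine on each edge, so its values at the vertices decide. Parameters
  on different edges are compared through the vertices between them.\<close>

lemma path_point_inner_mono:
  assumes mono: "\<And>i. Suc i < length vs \<Longrightarrow> e \<bullet> vs ! i \<le> e \<bullet> vs ! Suc i"
    and st: "0 \<le> s" "s \<le> t" "t \<le> real (length vs - 1)"
  shows "e \<bullet> path_point vs s \<le> e \<bullet> path_point vs t"
proof (cases "length vs \<le> 1")
  case True
  \<comment> \<open>Natural subtraction shrinks the parameter interval to the single point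
    0.\<close>
  then have "s = t" using st by simp
  then show ?thesis by simp
next
  case False
  define h where "h i = e \<bullet> vs ! i" for i
  \<comment> \<open>The cap places the final parameter \<open>length vs - 1\<close> at the end of
    the last edge.\<close>
  define i where "i = min (nat \<lfloor>s\<rfloor>) (length vs - 2)"
  define j where "j = min (nat \<lfloor>t\<rfloor>) (length vs - 2)"
  have hm: "h m \<le> h n" if "m \<le> n" "n < length vs" for m n
    using that
  proof (induction n rule: dec_induct)
    case (step n)
    then show ?case using mono[of n] by (simp add: h_def)
  qed simp
  have ps: "e \<bullet> path_point vs s = h i + (s - real i) * (h (Suc i) - h i)"
    unfolding path_point_def Let_def i_def[symmetric] h_def
    by (simp add: inner_add_right algebra_simps)
  have pt: "e \<bullet> path_point vs t = h j + (t - real j) * (h (Suc j) - h j)"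
    unfolding path_point_def Let_def j_def[symmetric] h_def
    by (simp add: inner_add_right algebra_simps)
  have ij: "i \<le> j"
    using st unfolding i_def j_def by (intro min.mono nat_mono floor_mono) auto
  have jl: "Suc j < length vs"
    using False by (simp add: j_def)
  have tj: "real j \<le> t"
    using st unfolding j_def by linarith
  show ?thesis
  proof (cases "i = j")
    case True
    then show ?thesis
      unfolding ps pt using hm[of j "Suc j"] jl st by (simp add: mult_right_mono)
  next
    case neq: False
    \<comment> \<open>An index strictly below \<open>j\<close> was not capped, so it is the floor of
      \<open>s\<close>.\<close>
    then have "i = nat \<lfloor>s\<rfloor>"
      using ij unfolding i_def j_def by linarith
    then have "s - real i \<le> 1"
      using st by linarith
    then have "(s - real i) * (h (Suc i) - h i) \<le> 1 * (h (Suc i) - h i)"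
      using hm[of i "Suc i"] ij jl by (intro mult_right_mono) auto
    then have "e \<bullet> path_point vs s \<le> h (Suc i)"
      unfolding ps by simp
    also have "\<dots> \<le> h j"
      using hm neq ij jl by simp
    also have "\<dots> \<le> e \<bullet> path_point vs t"
      unfolding pt using tj hm[of j "Suc j"] jl by simp
    finally show ?thesis .
  qed
qed

text \<open>Two displacements along the path lie in a common closed right angle, hence have a
  nonnegative inner product.\<close>
lemma quadrant_path_self_approaching:
  assumes fr: "frame e f" and path: "quadrant_path P S e f vs"
  shows "self_approaching vs"
  unfolding self_approaching_def Let_def
proof (intro allI impI)
  fix s t u
  assume A: "0 \<le> s \<and> s \<le> t \<and> t \<le> u \<and> u \<le> real (length vs - 1)"
    and D: "path_point vs s \<noteq> path_point vs t \<and> path_point vs t \<noteq> path_point vs u \<and>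
            path_point vs s \<noteq> path_point vs u"
  let ?a = "path_point vs s" and ?b = "path_point vs t" and ?c = "path_point vs u"
  have e: "e \<bullet> ?a \<le> e \<bullet> ?b" "e \<bullet> ?b \<le> e \<bullet> ?c"
    and f: "f \<bullet> ?a \<le> f \<bullet> ?b" "f \<bullet> ?b \<le> f \<bullet> ?c"
    using path A unfolding quadrant_path_def by (auto intro!: path_point_inner_mono)
  have "0 \<le> (?b - ?a) \<bullet> (?c - ?b)"
    using e f by (intro frame_inner_nonneg[OF fr]) (auto simp: inner_diff_right)
  \<comment> \<open>Expand \<open>c - a = (c - b) + (b - a)\<close>. Since \<open>a\<close> and
    \<open>b\<close> differ, the square of \<open>b - a\<close> makes the inequality strict.\<close>
  moreover have "(?c - ?a) \<bullet> (?c - ?a) =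
      (?c - ?b) \<bullet> (?c - ?b) + (?b - ?a) \<bullet> (?b - ?a) + 2 * ((?b - ?a) \<bullet> (?c - ?b))"
    by (simp add: inner_diff_left inner_diff_right inner_commute)
  moreover have "0 < (?b - ?a) \<bullet> (?b - ?a)"
    using D by auto
  ultimately have "(?c - ?b) \<bullet> (?c - ?b) < (?c - ?a) \<bullet> (?c - ?a)"
    by linarith
  then show "dist ?b ?c < dist ?a ?c"
    by (metis dist_commute dist_norm norm_lt)
qed

lemma quadrant_path_rev:
  assumes "quadrant_path P S e f vs"
  shows "quadrant_path P S (- e) (- f) (rev vs)"
  unfolding quadrant_path_def is_graph_path_def
proof (intro conjI allI impI)
  fix i assume i: "Suc i < length (rev vs)"
  \<comment> \<open>Edge \<open>i\<close> of the reversed list is edge \<open>j\<close> of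
    \<open>vs\<close> traversed backwards.\<close>
  define j where "j = length vs - Suc (Suc i)"
  have j: "Suc j < length vs" "rev vs ! i = vs ! Suc j" "rev vs ! Suc i = vs ! j"
    using i by (auto simp: j_def rev_nth Suc_diff_Suc)
  show "{rev vs ! i, rev vs ! Suc i} \<in> S"
    and "(- e) \<bullet> rev vs ! i \<le> (- e) \<bullet> rev vs ! Suc i"
    and "(- f) \<bullet> rev vs ! i \<le> (- f) \<bullet> rev vs ! Suc i"
    using assms j unfolding quadrant_path_def is_graph_path_def by (auto simp: insert_commute)
qed (use assms in \<open>auto simp: quadrant_path_def is_graph_path_def\<close>)

lemma quadrant_path_mono:
  "quadrant_path P S e f vs \<Longrightarrow> P \<subseteq> P' \<Longrightarrow> S \<subseteq> S' \<Longrightarrow> quadrant_path P' S' e f vs"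
  unfolding quadrant_path_def is_graph_path_def by (meson subset_trans subsetD)

lemma quadrant_path_Cons:
  assumes "quadrant_path P S e f vs" "u \<in> P" "{u, hd vs} \<in> S"
    "e \<bullet> u \<le> e \<bullet> hd vs" "f \<bullet> u \<le> f \<bullet> hd vs"
  shows "quadrant_path P S e f (u # vs)"
proof -
  have "vs \<noteq> []"
    using assms(1) by (simp add: quadrant_path_def is_graph_path_def)
  then have h: "hd vs = vs ! 0"
    by (rule hd_conv_nth)
  have "{(u # vs) ! i, (u # vs) ! Suc i} \<in> S \<and> e \<bullet> (u # vs) ! i \<le> e \<bullet> (u # vs) ! Suc i \<and>
      f \<bullet> (u # vs) ! i \<le> f \<bullet> (u # vs) ! Suc i" if "Suc i < length (u # vs)" for i
    using assms that h by (cases i) (simp_all add: quadrant_path_def is_graph_path_def)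
  then show ?thesis
    using assms(1,2) by (simp add: quadrant_path_def is_graph_path_def)
qed

lemma reachable_sym: "reachable P S u v \<Longrightarrow> reachable P S v u"
proof -
  assume "reachable P S u v"
  then obtain e f vs where "frame e f" "quadrant_path P S e f vs" "hd vs = u" "last vs = v"
    unfolding reachable_def by blast
  then have "frame (- e) (- f)" "quadrant_path P S (- e) (- f) (rev vs)"
      "hd (rev vs) = v" "last (rev vs) = u"
    by (simp_all add: frame_neg quadrant_path_rev hd_rev last_rev)
  then show ?thesis
    unfolding reachable_def by blast
qed

lemma reachable_mono: "reachable P S u v \<Longrightarrow> P \<subseteq> P' \<Longrightarrow> S \<subseteq> S' \<Longrightarrow> reachable P' S' u v"
  unfolding reachable_def using quadrant_path_mono by blast

text \<open>One path serves both directions: its reverse is a quadrant path for the negated frame,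
  hence self-approaching as well.\<close>

lemma increasing_chordI:
  assumes "geometric_graph P S" "\<And>u v. u \<in> P \<Longrightarrow> v \<in> P \<Longrightarrow> u \<noteq> v \<Longrightarrow> reachable P S u v"
  shows "increasing_chord P S"
  unfolding increasing_chord_def
proof (intro conjI ballI impI assms(1))
  fix u v assume "u \<in> P" "v \<in> P" "u \<noteq> v"
  then obtain e f vs where "frame e f" "quadrant_path P S e f vs" "hd vs = u" "last vs = v"
    using assms(2) unfolding reachable_def by blast
  moreover from this have "self_approaching vs" "self_approaching (rev vs)"
    by (meson quadrant_path_self_approaching quadrant_path_rev frame_neg)+
  ultimately show "\<exists>vs. is_graph_path P S vs \<and> hd vs = u \<and> last vs = v \<and>
      self_approaching vs \<and> self_approaching (rev vs)"
    unfolding quadrant_path_def by blast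
qed

section \<open>Outer normals\<close>

definition outer_normals :: "point set \<Rightarrow> (point \<Rightarrow> point) \<Rightarrow> bool" where
  "outer_normals P w \<longleftrightarrow> (\<forall>p\<in>P. \<forall>q\<in>P. p \<noteq> q \<longrightarrow> 0 < w p \<bullet> (p - q))"

lemma outer_normals_subset: "outer_normals P w \<Longrightarrow> Q \<subseteq> P \<Longrightarrow> outer_normals Q w"
  unfolding outer_normals_def by blast

text \<open>A line strictly separates \<open>p\<close> from the compact hull of the other points;
  its normal, oriented towards \<open>p\<close>, is the required direction.\<close>

lemma convex_point_set_outer_normals:
  assumes "convex_point_set P"
  shows "\<exists>w. outer_normals P w"
proof -
  have "\<exists>a. \<forall>q\<in>P. p \<noteq> q \<longrightarrow> 0 < a \<bullet> (p - q)" if p: "p \<in> P" for p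
  proof -
    have "closed (convex hull (P - {p}))"
      using assms unfolding convex_point_set_def
      by (intro compact_imp_closed finite_imp_compact_convex_hull) simp
    then obtain a b where "a \<bullet> p < b" "\<forall>x\<in>convex hull (P - {p}). b < a \<bullet> x"
      using separating_hyperplane_closed_point[of "convex hull (P - {p})" p] assms p
      unfolding convex_point_set_def by auto
    moreover have "q \<in> convex hull (P - {p})" if "q \<in> P" "p \<noteq> q" for q
      using that by (intro hull_inc) auto
    ultimately have "0 < (- a) \<bullet> (p - q)" if "q \<in> P" "p \<noteq> q" for q
      using that by (force simp: inner_diff_right)
    then show ?thesis by blast
  qed
  then show ?thesis
    unfolding outer_normals_def by metis
qed

text \<open>Up to a positive scale, the two products add up to \<open>w p \<bullet> (p - q)\<close>,
  which is positive because \<open>p\<close> is the strict maximum in direction \<open>w p\<close>.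
  The order of the chains rests on this contradiction.\<close>

lemma outer_normals_conflict:
  assumes "outer_normals P w" "frame e f" "p \<in> P" "q \<in> P" "p \<noteq> q"
    "(e \<bullet> w p) * (e \<bullet> p - e \<bullet> q) \<le> 0" "(f \<bullet> w p) * (f \<bullet> p - f \<bullet> q) \<le> 0"
  shows False
proof -
  have "w p \<bullet> (p - q) \<le> 0"
    using assms(6,7) by (intro frame_inner_nonpos[OF assms(2)]) (simp_all add: inner_diff_right)
  moreover have "0 < w p \<bullet> (p - q)"
    using assms(1,3-5) unfolding outer_normals_def by blast
  ultimately show False
    by simp
qed

section \<open>Linear-size graphs for two adjacent quadrants\<close>

text \<open>The left chain climbs to the right. A path starting on it follows the chain up to the last
  height not exceeding that of its target on the right chain, and then jumps to the target.\<close>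
lemma climbing_edges:
  assumes nor: "outer_normals P w" and fr: "frame e f"
    and fin: "finite A" "finite B" and sub: "A \<subseteq> P" "B \<subseteq> P" and disj: "A \<inter> B = {}"
    and A: "\<And>p. p \<in> A \<Longrightarrow> e \<bullet> w p \<le> 0 \<and> 0 \<le> f \<bullet> w p"
  shows "\<exists>S. geometric_graph P S \<and> finite S \<and> card S \<le> card A + card B \<and>
           (\<forall>p\<in>A. \<forall>q\<in>B. f \<bullet> p \<le> f \<bullet> q \<longrightarrow> reachable P S p q)"
proof -
  define next_up where "next_up p = arg_min_on ((\<bullet>) f) {z\<in>A. f \<bullet> p < f \<bullet> z}" for p
  \<comment> \<open>The highest point of \<open>A\<close> not above \<open>q\<close>; minimising the
    negated height gives a maximum.\<close>
  define foot where "foot q = arg_min_on (\<lambda>z. - (f \<bullet> z)) {z\<in>A. f \<bullet> z \<le> f \<bullet> q}" for q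
  \<comment> \<open>\<open>A'\<close> and \<open>B'\<close> keep the points for which the minimised
    sets are nonempty, so that \<open>next_up\<close> and \<open>foot\<close> are meaningful. One
    edge per such point gives the linear size.\<close>
  define A' where "A' = {p\<in>A. \<exists>z\<in>A. f \<bullet> p < f \<bullet> z}"
  define B' where "B' = {q\<in>B. \<exists>z\<in>A. f \<bullet> z \<le> f \<bullet> q}"
  define S where "S = (\<lambda>p. {p, next_up p}) ` A' \<union> (\<lambda>q. {foot q, q}) ` B'"
  \<comment> \<open>The normal of \<open>p\<close> points up and to the left. A point not lower than
    \<open>p\<close> and strictly to its left would be at least as extreme in that direction. As
    \<open>q\<close> ranges over \<open>P\<close>, this also covers the final jump.\<close>
  have chain: "e \<bullet> p \<le> e \<bullet> q" if "p \<in> A" "q \<in> P" "f \<bullet> p \<le> f \<bullet> q" for p q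
  proof (rule ccontr)
    assume "\<not> ?thesis"
    then show False
      using that A[of p] sub
      by (intro outer_normals_conflict[OF nor fr, of p q])
        (auto simp: mult_nonpos_nonneg mult_nonneg_nonpos)
  qed
  \<comment> \<open>By \<open>chain\<close> used both ways, equal heights in \<open>A\<close> force
    equal \<open>e\<close>-coordinates, and points with equal coordinates coincide.\<close>
  have inj: "p = q" if "p \<in> A" "q \<in> A" "f \<bullet> p = f \<bullet> q" for p q
  proof (rule ccontr)
    assume "p \<noteq> q"
    moreover have "e \<bullet> p = e \<bullet> q"
      using that chain[of p q] chain[of q p] sub by (simp add: subsetD)
    ultimately show False
      using that sub by (intro outer_normals_conflict[OF nor fr, of p q]) auto
  qed
  have next_up: "next_up p \<in> A" "f \<bullet> p < f \<bullet> next_up p"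
      "\<And>z. z \<in> A \<Longrightarrow> f \<bullet> p < f \<bullet> z \<Longrightarrow> f \<bullet> next_up p \<le> f \<bullet> z" if "p \<in> A'" for p
  proof -
    have X: "finite {z\<in>A. f \<bullet> p < f \<bullet> z}" "{z\<in>A. f \<bullet> p < f \<bullet> z} \<noteq> {}"
      using that fin by (auto simp: A'_def)
    show "next_up p \<in> A" "f \<bullet> p < f \<bullet> next_up p"
      using arg_min_if_finite(1)[OF X, of "(\<bullet>) f"] by (auto simp: next_up_def)
    show "f \<bullet> next_up p \<le> f \<bullet> z" if "z \<in> A" "f \<bullet> p < f \<bullet> z" for z
      using arg_min_least[OF X, of z "(\<bullet>) f"] that by (auto simp: next_up_def)
  qed
  have foot: "foot q \<in> A" "f \<bullet> foot q \<le> f \<bullet> q"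
      "\<And>z. z \<in> A \<Longrightarrow> f \<bullet> z \<le> f \<bullet> q \<Longrightarrow> f \<bullet> z \<le> f \<bullet> foot q" if "q \<in> B'" for q
  proof -
    have X: "finite {z\<in>A. f \<bullet> z \<le> f \<bullet> q}" "{z\<in>A. f \<bullet> z \<le> f \<bullet> q} \<noteq> {}"
      using that fin by (auto simp: B'_def)
    show "foot q \<in> A" "f \<bullet> foot q \<le> f \<bullet> q"
      using arg_min_if_finite(1)[OF X, of "\<lambda>z. - (f \<bullet> z)"] by (auto simp: foot_def)
    show "f \<bullet> z \<le> f \<bullet> foot q" if "z \<in> A" "f \<bullet> z \<le> f \<bullet> q" for z
      using arg_min_least[OF X, of z "\<lambda>z. - (f \<bullet> z)"] that by (auto simp: foot_def)
  qed
  have graph: "geometric_graph P S"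
    unfolding geometric_graph_def
  proof
    fix s assume "s \<in> S"
    then consider p where "p \<in> A'" "s = {p, next_up p}" | q where "q \<in> B'" "s = {foot q, q}"
      unfolding S_def by blast
    then show "\<exists>p q. p \<in> P \<and> q \<in> P \<and> p \<noteq> q \<and> s = {p, q}"
    proof cases
      case 1
      then show ?thesis
        using next_up[of p] sub by (intro exI[of _ p] exI[of _ "next_up p"]) (auto simp: A'_def)
    next
      case 2
      then show ?thesis
        using foot[of q] sub disj by (intro exI[of _ "foot q"] exI[of _ q]) (auto simp: B'_def)
    qed
  qed
  have "finite A'" "finite B'"
    using fin by (auto simp: A'_def B'_def)
  then have "card S \<le> card A' + card B'" "finite S"
    unfolding S_def
    by (auto intro!: order_trans[OF card_Un_le] add_mono card_image_le)
  moreover have "card A' \<le> card A" "card B' \<le> card B"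
    unfolding A'_def B'_def by (auto intro!: card_mono fin)
  ultimately have size: "finite S" "card S \<le> card A + card B"
    by auto
  have "\<exists>vs. quadrant_path P S e f vs \<and> hd vs = p \<and> last vs = q"
    if "p \<in> A" "q \<in> B" "f \<bullet> p \<le> f \<bullet> q" for p q
    using that
  \<comment> \<open>The measure counts the chain points above the start; it drops with each move to
    \<open>next_up p\<close>.\<close>
  proof (induction "card {z\<in>A. f \<bullet> p < f \<bullet> z}" arbitrary: p rule: less_induct)
    case less
    show ?case
    proof (cases "\<exists>z\<in>A. f \<bullet> p < f \<bullet> z \<and> f \<bullet> z \<le> f \<bullet> q")
      case True
      then have p: "p \<in> A'" using less.prems by (auto simp: A'_def)
      note nx = next_up[OF p]
      have "card {z\<in>A. f \<bullet> next_up p < f \<bullet> z} < card {z\<in>A. f \<bullet> p < f \<bullet> z}"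
      proof (rule psubset_card_mono)
        show "finite {z\<in>A. f \<bullet> p < f \<bullet> z}"
          using fin by simp
        have "{z\<in>A. f \<bullet> next_up p < f \<bullet> z} \<subseteq> {z\<in>A. f \<bullet> p < f \<bullet> z}"
          using nx(2) by auto
        moreover have "next_up p \<in> {z\<in>A. f \<bullet> p < f \<bullet> z}"
          using nx(1,2) by simp
        moreover have "next_up p \<notin> {z\<in>A. f \<bullet> next_up p < f \<bullet> z}"
          by simp
        ultimately show "{z\<in>A. f \<bullet> next_up p < f \<bullet> z} \<subset> {z\<in>A. f \<bullet> p < f \<bullet> z}"
          by blast
      qed
      moreover have "f \<bullet> next_up p \<le> f \<bullet> q"
        using True nx(3) by force
      ultimately obtain vs where vs: "quadrant_path P S e f vs" "hd vs = next_up p" "last vs = q"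
        using less.hyps[of "next_up p"] nx(1) less.prems(2) by blast
      have "e \<bullet> p \<le> e \<bullet> next_up p"
        using less.prems nx(1,2) sub by (intro chain) auto
      moreover have "{p, next_up p} \<in> S"
        using p by (simp add: S_def)
      ultimately have "quadrant_path P S e f (p # vs)"
        using vs nx(2) less.prems(1) sub by (intro quadrant_path_Cons) auto
      moreover have "vs \<noteq> []"
        using vs by (auto simp: quadrant_path_def is_graph_path_def)
      ultimately show ?thesis
        using vs by (intro exI[of _ "p # vs"]) auto
    next
      case False
      have q: "q \<in> B'" using less.prems by (auto simp: B'_def)
      \<comment> \<open>No chain point above \<open>p\<close> is within the height of
        \<open>q\<close>, so \<open>p\<close> is the last stop and its jump edge is present.\<close>
      have "foot q = p"
      proof (rule inj[OF foot(1)[OF q] less.prems(1)])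
        have "f \<bullet> p \<le> f \<bullet> foot q"
          using foot(3)[OF q] less.prems by blast
        moreover have "\<not> f \<bullet> p < f \<bullet> foot q"
          using False foot(1,2)[OF q] by blast
        ultimately show "f \<bullet> foot q = f \<bullet> p"
          by linarith
      qed
      then have "{p, q} \<in> S"
        using q by (auto simp: S_def)
      then have "quadrant_path P S e f [p, q]"
        using less.prems sub chain[of p q] by (auto simp: quadrant_path_def is_graph_path_def)
      then show ?thesis
        by (intro exI[of _ "[p, q]"]) auto
    qed
  qed
  then have "\<forall>p\<in>A. \<forall>q\<in>B. f \<bullet> p \<le> f \<bullet> q \<longrightarrow> reachable P S p q"
    using fr unfolding reachable_def by blast
  then show ?thesis
    using graph size by blast
qed

lemma geometric_graph_Un:
  "geometric_graph P S \<Longrightarrow> geometric_graph P T \<Longrightarrow> geometric_graph P (S \<union> T)"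
  by (simp add: geometric_graph_def ball_Un)

lemma geometric_graph_mono: "geometric_graph P S \<Longrightarrow> P \<subseteq> P' \<Longrightarrow> geometric_graph P' S"
  unfolding geometric_graph_def subset_iff by metis

text \<open>The lower point of a pair climbs its own chain and then jumps across. Mirroring
  \<open>e\<close> turns \<open>B\<close> into a left chain, so \<open>climbing_edges\<close>
  applies to both sides, at a cost of at most \<open>card P\<close> edges each.\<close>

lemma adjacent_quadrants:
  assumes nor: "outer_normals P w" and fr: "frame e f"
    and fin: "finite P" and sub: "A \<subseteq> P" "B \<subseteq> P" and disj: "A \<inter> B = {}"
    and A: "\<And>p. p \<in> A \<Longrightarrow> e \<bullet> w p \<le> 0 \<and> 0 \<le> f \<bullet> w p"
    and B: "\<And>p. p \<in> B \<Longrightarrow> 0 \<le> e \<bullet> w p \<and> 0 \<le> f \<bullet> w p"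
  shows "\<exists>S. geometric_graph P S \<and> finite S \<and> card S \<le> 2 * card P \<and>
           (\<forall>p\<in>A. \<forall>q\<in>B. reachable P S p q)"
proof -
  have finAB: "finite A" "finite B"
    using fin sub finite_subset by auto
  have AB: "card A + card B \<le> card P"
    using card_Un_disjoint[OF finAB disj] card_mono[of P "A \<union> B"] fin sub by simp
  obtain S where S: "geometric_graph P S" "finite S" "card S \<le> card A + card B"
      "\<forall>p\<in>A. \<forall>q\<in>B. f \<bullet> p \<le> f \<bullet> q \<longrightarrow> reachable P S p q"
    using climbing_edges[OF nor fr finAB sub disj A] by blast
  have disj': "B \<inter> A = {}" using disj by blast
  obtain T where T: "geometric_graph P T" "finite T" "card T \<le> card B + card A"
      "\<forall>p\<in>B. \<forall>q\<in>A. f \<bullet> p \<le> f \<bullet> q \<longrightarrow> reachable P T p q"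
    using climbing_edges[OF nor frame_mirror[OF fr] finAB(2,1) sub(2,1) disj'] B by fastforce
  have "reachable P (S \<union> T) p q" if "p \<in> A" "q \<in> B" for p q
  proof (cases "f \<bullet> p \<le> f \<bullet> q")
    case True
    then show ?thesis using S(4) that by (blast intro: reachable_mono)
  next
    case False
    then have "reachable P T q p" using T(4) that by simp
    then show ?thesis by (rule reachable_sym[OF reachable_mono[OF _ order_refl Un_upper2]])
  qed
  moreover have "card (S \<union> T) \<le> 2 * card P"
    using card_Un_le[of S T] S(3) T(3) AB by linarith
  ultimately show ?thesis
    using S T geometric_graph_Un by (intro exI[of _ "S \<union> T"]) blast
qed

text \<open>The sign of the product separates quadrants one and three from two and four, and every
  odd quadrant is adjacent to every even one. The constant 8 is four adjacent pairs at
  \<open>2 * card P\<close> edges each.\<close>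

lemma odd_even_quadrants:
  assumes nor: "outer_normals P w" and fr: "frame d d'" and fin: "finite P"
    and sub: "X \<subseteq> P" "Y \<subseteq> P" and disj: "X \<inter> Y = {}"
    and X: "\<And>p. p \<in> X \<Longrightarrow> 0 \<le> (d \<bullet> w p) * (d' \<bullet> w p)"
    and Y: "\<And>p. p \<in> Y \<Longrightarrow> (d \<bullet> w p) * (d' \<bullet> w p) \<le> 0"
  shows "\<exists>S. geometric_graph P S \<and> finite S \<and> card S \<le> 8 * card P \<and>
           (\<forall>p\<in>X. \<forall>q\<in>Y. reachable P S p q)"
proof -
  define X1 where "X1 = {p\<in>X. 0 \<le> d \<bullet> w p \<and> 0 \<le> d' \<bullet> w p}"
  define X3 where "X3 = {p\<in>X. d \<bullet> w p \<le> 0 \<and> d' \<bullet> w p \<le> 0}"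
  define Y2 where "Y2 = {p\<in>Y. d \<bullet> w p \<le> 0 \<and> 0 \<le> d' \<bullet> w p}"
  define Y4 where "Y4 = {p\<in>Y. 0 \<le> d \<bullet> w p \<and> d' \<bullet> w p \<le> 0}"
  have XU: "X = X1 \<union> X3" and YU: "Y = Y2 \<union> Y4"
    using X Y unfolding X1_def X3_def Y2_def Y4_def
    by (auto simp: zero_le_mult_iff mult_le_0_iff)
  note defs = X1_def X3_def Y2_def Y4_def
  \<comment> \<open>Quarter turns of the frame bring each of the four adjacent pairs into the
    position of quadrants two and one.\<close>
  have fr2: "frame d' (- d)" by (rule frame_rotate[OF fr])
  have fr3: "frame (- d) (- d')" by (rule frame_neg[OF fr])
  have fr4: "frame (- d') d" using frame_neg[OF fr2] by simp
  have "\<exists>S. geometric_graph P S \<and> finite S \<and> card S \<le> 2 * card P \<and>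
           (\<forall>p\<in>Y2. \<forall>q\<in>X1. reachable P S p q)"
    by (rule adjacent_quadrants[OF nor fr fin]) (use sub disj in \<open>auto simp: defs\<close>)
  then obtain S1 where S1: "geometric_graph P S1" "finite S1" "card S1 \<le> 2 * card P"
      "\<forall>p\<in>Y2. \<forall>q\<in>X1. reachable P S1 p q"
    by blast
  have "\<exists>S. geometric_graph P S \<and> finite S \<and> card S \<le> 2 * card P \<and>
           (\<forall>p\<in>X3. \<forall>q\<in>Y2. reachable P S p q)"
    by (rule adjacent_quadrants[OF nor fr2 fin]) (use sub disj in \<open>auto simp: defs\<close>)
  then obtain S2 where S2: "geometric_graph P S2" "finite S2" "card S2 \<le> 2 * card P"
      "\<forall>p\<in>X3. \<forall>q\<in>Y2. reachable P S2 p q"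
    by blast
  have "\<exists>S. geometric_graph P S \<and> finite S \<and> card S \<le> 2 * card P \<and>
           (\<forall>p\<in>Y4. \<forall>q\<in>X3. reachable P S p q)"
    by (rule adjacent_quadrants[OF nor fr3 fin]) (use sub disj in \<open>auto simp: defs\<close>)
  then obtain S3 where S3: "geometric_graph P S3" "finite S3" "card S3 \<le> 2 * card P"
      "\<forall>p\<in>Y4. \<forall>q\<in>X3. reachable P S3 p q"
    by blast
  have "\<exists>S. geometric_graph P S \<and> finite S \<and> card S \<le> 2 * card P \<and>
           (\<forall>p\<in>X1. \<forall>q\<in>Y4. reachable P S p q)"
    by (rule adjacent_quadrants[OF nor fr4 fin]) (use sub disj in \<open>auto simp: defs\<close>)
  then obtain S4 where S4: "geometric_graph P S4" "finite S4" "card S4 \<le> 2 * card P"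
      "\<forall>p\<in>X1. \<forall>q\<in>Y4. reachable P S4 p q"
    by blast
  define S where "S = S1 \<union> S2 \<union> (S3 \<union> S4)"
  have Ssub: "S1 \<subseteq> S" "S2 \<subseteq> S" "S3 \<subseteq> S" "S4 \<subseteq> S"
    by (auto simp: S_def)
  have "card S \<le> 8 * card P"
    unfolding S_def
    using card_Un_le[of "S1 \<union> S2" "S3 \<union> S4"] card_Un_le[of S1 S2] card_Un_le[of S3 S4]
      S1(3) S2(3) S3(3) S4(3) by linarith
  moreover have "geometric_graph P S" "finite S"
    unfolding S_def using S1 S2 S3 S4 by (auto intro!: geometric_graph_Un)
  moreover have "reachable P S p q" if "p \<in> X" "q \<in> Y" for p q
  proof -
    have "p \<in> X1 \<or> p \<in> X3" "q \<in> Y2 \<or> q \<in> Y4"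
      using that XU YU by auto
    then consider "reachable P S1 q p" | "reachable P S2 p q" | "reachable P S3 q p"
      | "reachable P S4 p q"
      using S1(4) S2(4) S3(4) S4(4) by blast
    then have "reachable P S p q \<or> reachable P S q p"
      by cases (use reachable_mono[OF _ order_refl] Ssub in blast)+
    then show ?thesis
      using reachable_sym by blast
  qed
  ultimately show ?thesis by blast
qed

section \<open>Balanced splitting\<close>

text \<open>Having more than \<open>k\<close> positive values is an open condition: a union, over
  the subsets \<open>Q\<close> with more than \<open>k\<close> elements, of finite intersections of
  open sets.\<close>

lemma closed_card_pos_le:
  fixes g :: "'a \<Rightarrow> real \<Rightarrow> real"
  assumes fin: "finite P" and cont: "\<And>p. continuous_on UNIV (g p)"
  shows "closed {t. card {p\<in>P. 0 < g p t} \<le> k}"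
proof -
  have "- {t. card {p\<in>P. 0 < g p t} \<le> k} =
      (\<Union>Q\<in>{Q. Q \<subseteq> P \<and> k < card Q}. \<Inter>p\<in>Q. {t. 0 < g p t})" (is "?L = ?R")
  proof
    show "?L \<subseteq> ?R"
    proof
      fix t assume "t \<in> ?L"
      then have "{p\<in>P. 0 < g p t} \<in> {Q. Q \<subseteq> P \<and> k < card Q}"
        by simp
      moreover have "t \<in> (\<Inter>p\<in>{p\<in>P. 0 < g p t}. {t. 0 < g p t})"
        by simp
      ultimately show "t \<in> ?R"
        by (rule UN_I)
    qed
    show "?R \<subseteq> ?L"
    proof
      fix t assume "t \<in> ?R"
      then obtain Q where "Q \<subseteq> P" "k < card Q" "\<forall>p\<in>Q. 0 < g p t" by auto
      moreover from this have "card Q \<le> card {p\<in>P. 0 < g p t}"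
        using fin by (intro card_mono) auto
      ultimately show "t \<in> ?L" by simp
    qed
  qed
  moreover have "open ?R"
    using fin cont
    by (intro open_UN ballI open_INT) (auto intro: finite_subset open_Collect_less)
  ultimately show ?thesis
    by (simp add: closed_def)
qed

text \<open>The open sets of parameters with a majority of positive, respectively negative, values are
  disjoint and exchanged between the endpoints, so they cannot cover the interval.\<close>
lemma halving_parameter:
  fixes g :: "'a \<Rightarrow> real \<Rightarrow> real"
  assumes fin: "finite P" and cont: "\<And>p. continuous_on UNIV (g p)"
    and flip: "\<And>p. g p 1 = - g p 0"
  shows "\<exists>t. 2 * card {p\<in>P. 0 < g p t} \<le> card P \<and> 2 * card {p\<in>P. g p t < 0} \<le> card P"
proof -
  let ?k = "card P div 2"
  \<comment> \<open>\<open>U\<close> and \<open>V\<close> are the closed complements of the two open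
    sets; a common point is the desired parameter.\<close>
  define U where "U = {t. card {p\<in>P. 0 < g p t} \<le> ?k}"
  define V where "V = {t. card {p\<in>P. 0 < - g p t} \<le> ?k}"
  have "closed U" "closed V"
    unfolding U_def V_def using cont
    by (intro closed_card_pos_le[OF fin] continuous_on_minus; simp)+
  \<comment> \<open>The positive and the negative points form disjoint sets, so at most one of them
    exceeds half.\<close>
  moreover have cover: "t \<in> U \<union> V" for t
  proof -
    have "card {p\<in>P. 0 < g p t} + card {p\<in>P. 0 < - g p t}
        = card ({p\<in>P. 0 < g p t} \<union> {p\<in>P. 0 < - g p t})"
      using fin by (intro card_Un_disjoint[symmetric]) auto
    also have "\<dots> \<le> card P"
      using fin by (intro card_mono) auto
    finally show ?thesis
      unfolding U_def V_def by auto
  qed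
  \<comment> \<open>The sign flip exchanges the roles of \<open>U\<close> and \<open>V\<close>: if
    one contains 0, the other contains 1. Hence both meet the interval.\<close>
  moreover have "0 \<in> U \<longleftrightarrow> 1 \<in> V" "0 \<in> V \<longleftrightarrow> 1 \<in> U"
    unfolding U_def V_def by (simp_all add: flip)
  then have "U \<inter> {0..1} \<noteq> {}" "V \<inter> {0..1} \<noteq> {}"
    using cover[of 0] by auto
  ultimately have "U \<inter> V \<inter> {0..1} \<noteq> {}"
    using connected_closedD[OF connected_Icc[of "0::real" 1], of U V] by blast
  then obtain t where "t \<in> U" "t \<in> V" by blast
  then show ?thesis
    unfolding U_def V_def by (intro exI[of _ t]) auto
qed

text \<open>From \<open>t = 0\<close> to \<open>t = 1\<close> the frame makes a quarter turn, which
  negates the product. Moving \<open>d\<close> along a segment that misses the origin keeps the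
  product polynomial, hence continuous, in \<open>t\<close>.\<close>

lemma balanced_frame:
  fixes w :: "point \<Rightarrow> point"
  assumes "finite P"
  shows "\<exists>d d'. frame d d' \<and>
           2 * card {p\<in>P. 0 < (d \<bullet> w p) * (d' \<bullet> w p)} \<le> card P \<and>
           2 * card {p\<in>P. (d \<bullet> w p) * (d' \<bullet> w p) < 0} \<le> card P"
proof -
  define d d' :: "real \<Rightarrow> point" where "d t = vector [1 - t, t]" and "d' t = vector [- t, 1 - t]" for t
  define g where "g p t = (d t \<bullet> w p) * (d' t \<bullet> w p)" for p t
  have g: "g p t = ((1 - t) * (w p $ 1) + t * (w p $ 2)) * (- t * (w p $ 1) + (1 - t) * (w p $ 2))" for p t
    by (simp add: g_def d_def d'_def inner_vec_def sum_2)
  have "continuous_on UNIV (g p)" for p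
    unfolding g by (intro continuous_intros)
  moreover have "g p 1 = - g p 0" for p
    by (simp add: g)
  ultimately obtain t where
    "2 * card {p\<in>P. 0 < g p t} \<le> card P" "2 * card {p\<in>P. g p t < 0} \<le> card P"
    using halving_parameter[OF assms] by blast
  moreover have "frame (d t) (d' t)"
    unfolding d_def d'_def by (intro frame_coordinates) auto
  ultimately show ?thesis
    unfolding g_def by blast
qed

section \<open>Recursion on the two halves\<close>

text \<open>Each level of the halving costs at most 8 edges per point, and \<open>k\<close> bounds
  the number of levels. The normals \<open>w\<close> are kept for the subsets; only the frame is
  chosen anew.\<close>

lemma reachable_graph:
  assumes "finite P" "outer_normals P w" "card P \<le> 2 ^ k"
  shows "\<exists>S. geometric_graph P S \<and> finite S \<and> card S \<le> 8 * k * card P \<and>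
           (\<forall>p\<in>P. \<forall>q\<in>P. p \<noteq> q \<longrightarrow> reachable P S p q)"
  using assms
proof (induction k arbitrary: P)
  case 0
  then have "\<forall>p\<in>P. \<forall>q\<in>P. p = q"
    by (auto simp: card_le_Suc0_iff_eq)
  then show ?case
    by (intro exI[of _ "{}"]) (auto simp: geometric_graph_def)
next
  case (Suc k)
  note fin = Suc.prems(1) and nor = Suc.prems(2)
  obtain d d' where fr: "frame d d'"
    and pos: "2 * card {p\<in>P. 0 < (d \<bullet> w p) * (d' \<bullet> w p)} \<le> card P"
    and neg: "2 * card {p\<in>P. (d \<bullet> w p) * (d' \<bullet> w p) < 0} \<le> card P"
    using balanced_frame[OF fin] by blast
  let ?Pos = "{p\<in>P. 0 < (d \<bullet> w p) * (d' \<bullet> w p)}"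
  let ?Neg = "{p\<in>P. (d \<bullet> w p) * (d' \<bullet> w p) < 0}"
  have "card (P - ?Neg) = card P - card ?Neg"
    using fin by (intro card_Diff_subset) auto
  then have "card ?Pos \<le> card P div 2" "card P div 2 \<le> card (P - ?Neg)"
    using pos neg by linarith+
  moreover have "?Pos \<subseteq> P - ?Neg" "finite (P - ?Neg)"
    using fin by auto
  \<comment> \<open>Points whose normal lies on an axis of the frame fit either class. Distributing
    them suitably makes \<open>X\<close> exactly half, rounded down.\<close>
  ultimately obtain X where X: "?Pos \<subseteq> X" "X \<subseteq> P - ?Neg" "card X = card P div 2"
    using exists_subset_between[of ?Pos "card P div 2" "P - ?Neg"] by blast
  define Y where "Y = P - X"
  have sub: "X \<subseteq> P" "Y \<subseteq> P" and disj: "X \<inter> Y = {}" and PU: "P = X \<union> Y"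
    using X by (auto simp: Y_def)
  have finXY: "finite X" "finite Y"
    using sub fin finite_subset by auto
  have cardP: "card P = card X + card Y"
    using PU card_Un_disjoint[OF finXY disj] by simp
  have bounds: "card X \<le> 2 ^ k" "card Y \<le> 2 ^ k"
    using cardP X(3) Suc.prems(3) by auto
  obtain S where S: "geometric_graph X S" "finite S" "card S \<le> 8 * k * card X"
      "\<forall>p\<in>X. \<forall>q\<in>X. p \<noteq> q \<longrightarrow> reachable X S p q"
    using Suc.IH[OF finXY(1) outer_normals_subset[OF nor sub(1)] bounds(1)] by blast
  obtain T where T: "geometric_graph Y T" "finite T" "card T \<le> 8 * k * card Y"
      "\<forall>p\<in>Y. \<forall>q\<in>Y. p \<noteq> q \<longrightarrow> reachable Y T p q"
    using Suc.IH[OF finXY(2) outer_normals_subset[OF nor sub(2)] bounds(2)] by blast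
  have "0 \<le> (d \<bullet> w p) * (d' \<bullet> w p)" if "p \<in> X" for p
    using X(2) that by (auto simp: not_less)
  moreover have "(d \<bullet> w p) * (d' \<bullet> w p) \<le> 0" if "p \<in> Y" for p
    using X(1) that by (auto simp: Y_def not_less)
  ultimately obtain R where R: "geometric_graph P R" "finite R" "card R \<le> 8 * card P"
      "\<forall>p\<in>X. \<forall>q\<in>Y. reachable P R p q"
    using odd_even_quadrants[OF nor fr fin sub disj] by blast
  define E where "E = S \<union> T \<union> R"
  have Esub: "S \<subseteq> E" "T \<subseteq> E" "R \<subseteq> E"
    by (auto simp: E_def)
  have "geometric_graph P E" "finite E"
    unfolding E_def using S T R sub by (auto intro!: geometric_graph_Un intro: geometric_graph_mono)
  moreover have "card E \<le> 8 * Suc k * card P"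
  proof -
    have "card E \<le> card S + card T + card R"
      unfolding E_def using card_Un_le[of "S \<union> T" R] card_Un_le[of S T] by linarith
    also have "\<dots> \<le> 8 * k * card X + 8 * k * card Y + 8 * card P"
      using S(3) T(3) R(3) by linarith
    also have "\<dots> = 8 * Suc k * card P"
      by (simp add: cardP algebra_simps)
    finally show ?thesis .
  qed
  moreover have "reachable P E p q" if "p \<in> P" "q \<in> P" "p \<noteq> q" for p q
  proof -
    have "p \<in> X \<or> p \<in> Y" "q \<in> X \<or> q \<in> Y"
      using that by (auto simp: Y_def)
    then consider "p \<in> X" "q \<in> X" | "p \<in> Y" "q \<in> Y" | "p \<in> X" "q \<in> Y" | "p \<in> Y" "q \<in> X"
      by blast
    then show ?thesis
    proof cases
      case 1
      then show ?thesis using S(4) that(3) sub Esub by (blast intro: reachable_mono)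
    next
      case 2
      then show ?thesis using T(4) that(3) sub Esub by (blast intro: reachable_mono)
    next
      case 3
      then show ?thesis using R(4) Esub by (blast intro: reachable_mono)
    next
      case 4
      then have "reachable P R q p" using R(4) by blast
      then show ?thesis by (rule reachable_sym[OF reachable_mono[OF _ order_refl Esub(3)]])
    qed
  qed
  ultimately show ?case by blast
qed

section \<open>Recursion depth and the final bound\<close>

theorem theorem2:
  shows "\<exists>C::real. \<forall>P::point set. convex_point_set P \<and> card P \<ge> 2 \<longrightarrow>
           (\<exists>S. increasing_chord P S \<and>
                real (card S) \<le> C * real (card P) * ln (real (card P)))"
\<comment> \<open>The constant comes from \<open>8 * k * n\<close> with \<open>k\<close> at most
  \<open>2 * log 2 n\<close>, after passing to natural logarithms.\<close>
proof (intro exI[of _ "16 / ln 2"] allI impI)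
  fix P :: "point set"
  assume P: "convex_point_set P \<and> card P \<ge> 2"
  define n where "n = card P"
  define k where "k = nat \<lceil>log 2 n\<rceil>"
  have n: "2 \<le> n" using P by (simp add: n_def)
  then have log1: "1 \<le> log 2 n" by simp
  have "real n = 2 powr (log 2 n)" using n by simp
  also have "\<dots> \<le> 2 powr (real k)"
    using log1 unfolding k_def by (intro powr_mono) linarith+
  finally have "real n \<le> real (2 ^ k)" by (simp add: powr_realpow)
  then have nk: "n \<le> 2 ^ k" by (simp only: of_nat_le_iff)
  \<comment> \<open>Rounding up adds less than 1, which is at most \<open>log 2 n\<close> since
    \<open>n\<close> is at least 2.\<close>
  have k: "real k \<le> 2 * log 2 n"
    using log1 unfolding k_def by linarith
  obtain w where "outer_normals P w"
    using convex_point_set_outer_normals P by blast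
  then obtain S where S: "geometric_graph P S" "card S \<le> 8 * k * n"
      "\<forall>p\<in>P. \<forall>q\<in>P. p \<noteq> q \<longrightarrow> reachable P S p q"
    using reachable_graph[of P w k] P nk unfolding n_def convex_point_set_def by blast
  have "real (card S) \<le> real (8 * k * n)"
    using S(2) by (simp only: of_nat_le_iff)
  also have "\<dots> \<le> 8 * (2 * log 2 n) * n"
    using k by (simp add: mult_right_mono)
  also have "\<dots> = 16 / ln 2 * real (card P) * ln (real (card P))"
    by (simp add: log_def n_def)
  finally show "\<exists>S. increasing_chord P S \<and>
      real (card S) \<le> 16 / ln 2 * real (card P) * ln (real (card P))"
    using increasing_chordI S by blast
qed

end
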